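(* Let $\mathbf{F}_2$ be the finite field with two elements, $f\in MF_n^n(\mathbf{F}_2)$ a Boolean coupled monomial dynamical system and $G_f$ its dependency graph. Then $f$ is a fixed point system if and only if the loop number of each nontrivial strongly connected component of $G_f$ is equal to $1$.
   Context: Convention: $x^0=1$ for all $x\in\mathbf{F}_2$. A (Boolean) monomial dynamical system $f\in MF_n^n(\mathbf{F}_2)$ ($n$ a positive integer) is a map $f:\mathbf{F}_2^n\to\mathbf{F}_2^n$ for which there is a (necessarily unique) $n\times n$ matrix $F$ with entries in $\{0,1\}$ such that $f_i(x)=x_1^{F_{i1}}\cdots x_n^{F_{in}}$ for all $x\in\mathbf{F}_2^n$ and all $i$. $f$ is a fixed point system if every trajectory $x,f(x),f^2(x),\dots$ ends in a fixed point of $f$; equivalently there is $m\ge1$ with $f^{m+\lambda}=f^m$ for all $\lambda\ge1$. The dependency graph $G_f$ of $f$ is the directed graph with vertices $a_1,\dots,a_n$ and exactly $F_{ij}$ directed edges from $a_i$ to $a_j$ for all $i,j$ (self loops allowed). A sequence of length $s$ from $a$ to $b$ is a directed walk consisting of $s$ edges (repetitions allowed). Strongly connected components are the usual ones; a strongly connected component is trivial if it consists of a single vertex $a$ and there is no edge $a\to a$. $f$ is coupled if $G_f$ contains nontrivial strongly connected components. The loop number of a vertex $a$ is the minimum of $|u-v|$ over all pairs $u\neq v$ such that there are sequences of length $u$ and of length $v$ from $a$ to $a$ (and it is $0$ if there is no sequence of positive length from $a$ to $a$). The loop number is the same for all vertices of a nontrivial strongly connected component, and this common value is called the loop number of the component.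 *)

theory Defs
  imports
    "HOL-Analysis.Finite_Cartesian_Product"
    "HOL-Library.Z2"
    "Graph_Theory.Digraph_Component"
begin

text \<open>
  The field with two elements is \<^typ>\<open>bit\<close>, and the index set \<open>{1, \<dots>, n}\<close> is a finite type
  \<open>'n\<close>. In \<^theory>\<open>HOL.Power\<close> \<open>x ^ 0 = 1\<close> for every \<open>x\<close>, zero included.
\<close>

definition exponent_matrix :: "(bit ^ 'n \<Rightarrow> bit ^ 'n) \<Rightarrow> nat ^ 'n ^ 'n \<Rightarrow> bool" where
  "exponent_matrix f F \<longleftrightarrow>
     (\<forall>i j. F $ i $ j \<in> {0, 1}) \<and> (\<forall>x i. f x $ i = (\<Prod>j\<in>UNIV. (x $ j) ^ (F $ i $ j)))"

definition monomial_system :: "(bit ^ 'n \<Rightarrow> bit ^ 'n) \<Rightarrow> bool" where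
  "monomial_system f \<longleftrightarrow> (\<exists>F. exponent_matrix f F)"

definition matrix_of :: "(bit ^ 'n \<Rightarrow> bit ^ 'n) \<Rightarrow> nat ^ 'n ^ 'n" where
  "matrix_of f = (THE F. exponent_matrix f F)"

lemma exponent_matrix_entry:
  assumes "exponent_matrix f F"
  shows "F $ i $ j = (if f (\<chi> k. if k = j then 0 else 1) $ i = 1 then 0 else 1)"
proof -
  have "f (\<chi> k. if k = j then 0 else 1) $ i
      = (\<Prod>k\<in>UNIV. (if k = j then 0 else 1) ^ (F $ i $ k))"
    using assms by (simp add: exponent_matrix_def)
  also have "\<dots> = (\<Prod>k\<in>UNIV. if k = j then 0 ^ (F $ i $ k) else 1)"
    by (intro prod.cong) auto
  also have "\<dots> = 0 ^ (F $ i $ j)"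
    by simp
  finally show ?thesis
    using assms by (force simp: exponent_matrix_def)
qed

lemma exponent_matrix_unique:
  "exponent_matrix f F \<Longrightarrow> exponent_matrix f F' \<Longrightarrow> F = F'"
  by (simp add: vec_eq_iff exponent_matrix_entry)

lemma exponent_matrix_matrix_of:
  "monomial_system f \<Longrightarrow> exponent_matrix f (matrix_of f)"
  unfolding monomial_system_def matrix_of_def
  by (metis exponent_matrix_unique theI)

definition fixed_point_system :: "('a \<Rightarrow> 'a) \<Rightarrow> bool" where
  "fixed_point_system f \<longleftrightarrow> (\<forall>x. \<exists>m. f ((f ^^ m) x) = (f ^^ m) x)"

text \<open>
  The entries of the matrix are \<open>0\<close> or \<open>1\<close>, so there are no parallel arcs and an arc is the pair
  of its ends.
\<close>

definition dependency_graph :: "(bit ^ 'n \<Rightarrow> bit ^ 'n) \<Rightarrow> ('n, 'n \<times> 'n) pre_digraph" where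
  "dependency_graph f =
     \<lparr>verts = UNIV, arcs = {(i, j). matrix_of f $ i $ j = 1}, tail = fst, head = snd\<rparr>"

lemma wf_dependency_graph: "wf_digraph (dependency_graph f)"
  by unfold_locales (simp_all add: dependency_graph_def)

context pre_digraph
begin

definition has_sequence :: "'a \<Rightarrow> nat \<Rightarrow> 'a \<Rightarrow> bool" where
  "has_sequence a s b \<longleftrightarrow> (\<exists>p. awalk a p b \<and> length p = s)"

text \<open>
  If \<open>a\<close> lies on a closed walk of length \<open>u > 0\<close>, it also lies on one of length \<open>2 * u\<close>, so the
  minimum in the second case is over a nonempty set.
\<close>

definition loop_number :: "'a \<Rightarrow> nat" where
  "loop_number a =
     (if \<forall>s>0. \<not> has_sequence a s a then 0
      else LEAST d. \<exists>u v. u \<noteq> v \<and> has_sequence a u a \<and> has_sequence a v a \<and>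
                          int d = \<bar>int u - int v\<bar>)"

definition trivial_scc :: "('a, 'b) pre_digraph \<Rightarrow> bool" where
  "trivial_scc H \<longleftrightarrow> (\<exists>a. verts H = {a} \<and> \<not> (\<exists>e\<in>arcs G. tail G e = a \<and> head G e = a))"

definition nontrivial_sccs :: "('a, 'b) pre_digraph set" where
  "nontrivial_sccs = {H \<in> sccs. \<not> trivial_scc H}"

text \<open>The closed walks are those of \<open>G\<close>; being closed, they never leave the component.\<close>

definition scc_loop_number :: "('a, 'b) pre_digraph \<Rightarrow> nat" where
  "scc_loop_number H = (THE l. \<forall>a\<in>verts H. loop_number a = l)"

end

context wf_digraph
begin

lemma has_sequence_trans:
  "has_sequence a s b \<Longrightarrow> has_sequence b t c \<Longrightarrow> has_sequence a (s + t) c"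
  unfolding has_sequence_def by (metis awalk_appendI length_append)

lemma loop_number_attained:
  assumes "s > 0" "has_sequence a s a"
  obtains u v where "u \<noteq> v" "has_sequence a u a" "has_sequence a v a"
    "int (loop_number a) = \<bar>int u - int v\<bar>"
proof -
  let ?P = "\<lambda>d. \<exists>u v. u \<noteq> v \<and> has_sequence a u a \<and> has_sequence a v a \<and>
                       int d = \<bar>int u - int v\<bar>"
  have "has_sequence a (s + s) a"
    using assms has_sequence_trans by blast
  then have "?P s"
    using assms by (intro exI[of _ "s + s"] exI[of _ s]) auto
  then have least: "?P (LEAST d. ?P d)"
    by (rule LeastI)
  have "\<not> (\<forall>s>0. \<not> has_sequence a s a)"
    using assms by blast
  then have "loop_number a = (LEAST d. ?P d)"
    by (simp only: loop_number_def if_False)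
  with least have "?P (loop_number a)"
    by (simp only:)
  then show ?thesis
    by (elim exE conjE) (rule that)
qed

lemma loop_number_le:
  assumes "u \<noteq> v" "has_sequence a u a" "has_sequence a v a"
  shows "int (loop_number a) \<le> \<bar>int u - int v\<bar>"
proof -
  let ?P = "\<lambda>d. \<exists>u v. u \<noteq> v \<and> has_sequence a u a \<and> has_sequence a v a \<and>
                       int d = \<bar>int u - int v\<bar>"
  have "?P (nat \<bar>int u - int v\<bar>)"
    using assms by auto
  then have "(LEAST d. ?P d) \<le> nat \<bar>int u - int v\<bar>"
    by (rule Least_le)
  moreover have "\<not> (\<forall>s>0. \<not> has_sequence a s a)"
    using assms by (metis gr0I)
  then have "loop_number a = (LEAST d. ?P d)"
    by (simp only: loop_number_def if_False)
  ultimately show ?thesis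
    by linarith
qed

lemma loop_number_mono:
  assumes "has_sequence a s b" "has_sequence b t a"
  shows "loop_number b \<le> loop_number a"
proof (cases "\<exists>r>0. has_sequence a r a")
  case True
  then obtain u v where uv: "u \<noteq> v" "has_sequence a u a" "has_sequence a v a"
      "int (loop_number a) = \<bar>int u - int v\<bar>"
    using loop_number_attained by blast
  have "has_sequence b (t + w + s) b" if "has_sequence a w a" for w
    using assms that has_sequence_trans by blast
  then have "int (loop_number b) \<le> \<bar>int (t + u + s) - int (t + v + s)\<bar>"
    using uv by (intro loop_number_le) auto
  with uv(4) show ?thesis
    by simp
next
  case False
  then have "\<not> has_sequence b r b" if "r > 0" for r
    using has_sequence_trans[OF assms(1) has_sequence_trans[OF _ assms(2)]] that
    by (meson add_gr_0)
  then have "loop_number b = 0"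
    by (simp add: loop_number_def)
  then show ?thesis
    by simp
qed

lemma scc_loop_number_eq:
  assumes "H \<in> sccs" "a \<in> verts H"
  shows "scc_loop_number H = loop_number a"
proof -
  have seq: "\<exists>s. has_sequence b s c" if "b \<in> verts H" "c \<in> verts H" for b c
  proof -
    have "verts H \<in> sccs_verts"
      using assms(1) by (simp add: sccs_verts_conv)
    then have "b \<rightarrow>\<^sup>* c"
      using that in_sccs_verts_conv_reachable by blast
    then show ?thesis
      unfolding has_sequence_def by (metis reachable_awalk)
  qed
  have eq: "loop_number b = loop_number a" if "b \<in> verts H" for b
  proof -
    from seq[OF that assms(2)] obtain s where s: "has_sequence b s a" ..
    from seq[OF assms(2) that] obtain t where t: "has_sequence a t b" ..
    show ?thesis
      using loop_number_mono[OF s t] loop_number_mono[OF t s] by simp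
  qed
  show ?thesis
    unfolding scc_loop_number_def
  proof (rule the_equality)
    show "\<forall>b\<in>verts H. loop_number b = loop_number a"
      using eq by blast
  qed (use assms(2) in simp)
qed

end

definition coupled :: "(bit ^ 'n \<Rightarrow> bit ^ 'n) \<Rightarrow> bool" where
  "coupled f \<longleftrightarrow> pre_digraph.nontrivial_sccs (dependency_graph f) \<noteq> {}"

end

theory Submission
  imports Defs
begin

text \<open>
  The \<open>i\<close>-th coordinate of \<open>f\<^sup>m x\<close> vanishes iff a sequence of length \<open>m\<close> leads from \<open>i\<close> to a zero
  coordinate of \<open>x\<close>. If \<open>f\<close> is a fixed point system and \<open>a\<close> lies on a closed walk, start at the
  point whose only zero is at \<open>a\<close>: its orbit becomes constant with \<open>a\<close>-coordinate \<open>0\<close>, so there are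
  closed walks at \<open>a\<close> of two consecutive lengths. Conversely, closed walks of consecutive lengths
  at \<open>a\<close> generate closed walks at \<open>a\<close> of all large lengths. A long walk meets such a vertex, so it
  can be extended by any large amount; on a periodic orbit this makes the zero sets increase, hence
  constant.
\<close>

section \<open>Lengths of closed walks and nontrivial components\<close>

context wf_digraph
begin

lemma has_sequence_0: "has_sequence a 0 b \<longleftrightarrow> a = b \<and> a \<in> verts G"
  by (auto simp: has_sequence_def awalk_Nil_iff)

lemma has_sequence_Suc:
  "has_sequence a (Suc s) b \<longleftrightarrow> (\<exists>e\<in>arcs G. tail G e = a \<and> has_sequence (head G e) s b)"
proof
  assume "has_sequence a (Suc s) b"
  then obtain e p where "awalk a (e # p) b" "length p = s"
    unfolding has_sequence_def length_Suc_conv by blast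
  then show "\<exists>e\<in>arcs G. tail G e = a \<and> has_sequence (head G e) s b"
    unfolding has_sequence_def awalk_Cons_iff by blast
next
  assume "\<exists>e\<in>arcs G. tail G e = a \<and> has_sequence (head G e) s b"
  then obtain e p where "awalk a (e # p) b" "length p = s"
    unfolding has_sequence_def awalk_Cons_iff by blast
  then show "has_sequence a (Suc s) b"
    unfolding has_sequence_def by (intro exI[of _ "e # p"]) simp
qed

lemma has_sequence_reachable: "has_sequence a s b \<Longrightarrow> a \<rightarrow>\<^sup>* b"
  unfolding has_sequence_def by (metis reachable_awalk)

lemma reachable_has_sequence: "a \<rightarrow>\<^sup>* b \<Longrightarrow> \<exists>s. has_sequence a s b"
  unfolding has_sequence_def by (metis reachable_awalk)

lemma has_sequence_in_verts: "has_sequence a s b \<Longrightarrow> a \<in> verts G"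
  unfolding has_sequence_def by auto

lemma has_sequence_mult:
  assumes "has_sequence a s a"
  shows "has_sequence a (k * s) a"
proof (induction k)
  case 0
  show ?case
    using has_sequence_in_verts[OF assms] by (simp add: has_sequence_0)
next
  case (Suc k)
  then show ?case
    using has_sequence_trans[OF assms] by simp
qed

text \<open>Writing \<open>l = q * u + r\<close> with \<open>r < u\<close>, take
  \<open>q - r\<close> rounds of length \<open>u\<close> and \<open>r\<close> rounds of length
  \<open>Suc u\<close>. This requires \<open>r \<le> q\<close>, which the bound
  \<open>u * u \<le> l\<close> ensures through \<open>u \<le> q\<close>.\<close>

lemma has_sequence_consecutive:
  assumes "has_sequence a u a" "has_sequence a (Suc u) a" "u * u \<le> l"
  shows "has_sequence a l a"
proof -
  let ?q = "l div u" and ?r = "l mod u"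
  have "(?q - ?r) * u + ?r * Suc u = l"
  \<comment> \<open>For \<open>u = 0\<close> the conventions \<open>l div 0 = 0\<close> and
    \<open>l mod 0 = l\<close> leave \<open>l\<close> rounds of length \<open>1\<close>.\<close>
  proof (cases "u = 0")
    case False
    then have "u \<le> ?q"
      using assms(3) by (simp add: less_eq_div_iff_mult_less_eq)
    moreover have "?r < u"
      using False by simp
    ultimately have "?q = (?q - ?r) + ?r"
      by linarith
    then have "?q * u = (?q - ?r) * u + ?r * u"
      by (metis add_mult_distrib)
    moreover have "?q * u + ?r = l"
      by simp
    ultimately show ?thesis
      by simp
  qed simp
  then show ?thesis
    using has_sequence_trans[OF has_sequence_mult[OF assms(1)] has_sequence_mult[OF assms(2)]]
    by metis
qed

lemma loop_number_eq_1_iff: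
  "loop_number a = 1 \<longleftrightarrow> (\<exists>u. has_sequence a u a \<and> has_sequence a (Suc u) a)"
proof
  assume one: "loop_number a = 1"
  \<comment> \<open>The value 1 rules out the default value 0, so a closed walk of positive length
    exists.\<close>
  then obtain s where "s > 0" "has_sequence a s a"
    by (auto simp: loop_number_def split: if_splits)
  then obtain u v where "has_sequence a u a" "has_sequence a v a" "1 = \<bar>int u - int v\<bar>"
    using loop_number_attained one by (metis of_nat_1)
  moreover from this have "u = Suc v \<or> v = Suc u"
    by linarith
  ultimately show "\<exists>u. has_sequence a u a \<and> has_sequence a (Suc u) a"
    by blast
next
  assume "\<exists>u. has_sequence a u a \<and> has_sequence a (Suc u) a"
  then obtain u where u: "has_sequence a u a" "has_sequence a (Suc u) a"
    by blast
  have "int (loop_number a) \<le> 1"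
    using loop_number_le[OF _ u] by simp
  moreover obtain v w where "v \<noteq> w" "int (loop_number a) = \<bar>int v - int w\<bar>"
    using loop_number_attained[OF _ u(2)] by blast
  ultimately show "loop_number a = 1"
    by linarith
qed

text \<open>A single vertex of a nontrivial component carries a loop; otherwise a walk to another
  vertex and back is closed and has positive length.\<close>

lemma nontrivial_scc_closed_walk:
  assumes "H \<in> nontrivial_sccs" "a \<in> verts H"
  obtains s where "s > 0" "has_sequence a s a"
proof (cases "verts H = {a}")
  case True
  then obtain e where "e \<in> arcs G" "tail G e = a" "head G e = a"
    using assms by (auto simp: nontrivial_sccs_def trivial_scc_def)
  then have "has_sequence a 1 a"
    by (auto simp: has_sequence_Suc has_sequence_0)
  then show ?thesis
    using that zero_less_one by blast
next
  case False
  then obtain b where b: "b \<in> verts H" "b \<noteq> a"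
    using assms(2) by blast
  have "verts H \<in> sccs_verts"
    using assms(1) by (auto simp: nontrivial_sccs_def sccs_verts_conv)
  then have "a \<rightarrow>\<^sup>* b" "b \<rightarrow>\<^sup>* a"
    using assms(2) b(1) in_sccs_verts_conv_reachable by blast+
  then obtain s t where st: "has_sequence a s b" "has_sequence b t a"
    using reachable_has_sequence by blast
  then have "s \<noteq> 0"
    using b(2) by (metis has_sequence_0)
  then show ?thesis
    using that[OF _ has_sequence_trans[OF st]] by simp
qed

text \<open>The component of \<open>a\<close> serves: the head of the first arc of the closed walk
  leads back to \<open>a\<close>, hence lies in the same component. If \<open>a\<close> were its
  only vertex, that arc would be a loop.\<close>

lemma closed_walk_nontrivial_scc:
  assumes "s > 0" "has_sequence a s a"
  obtains H where "H \<in> nontrivial_sccs" "a \<in> verts H"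
proof -
  have a: "a \<in> verts G"
    using assms(2) by (rule has_sequence_in_verts)
  then obtain H where H: "H \<in> sccs" "verts H = scc_of a"
    using scc_of_in_sccs_verts by (force simp: sccs_verts_conv)
  have "a \<in> verts H"
    using a H(2) in_scc_of_self by blast
  moreover have "\<not> trivial_scc H"
  proof
    assume "trivial_scc H"
    then have single: "verts H = {a}"
      and no_loop: "\<not> (\<exists>e\<in>arcs G. tail G e = a \<and> head G e = a)"
      using \<open>a \<in> verts H\<close> by (auto simp: trivial_scc_def)
    obtain r where "s = Suc r"
      using assms(1) gr0_conv_Suc by blast
    then obtain e where e: "e \<in> arcs G" "tail G e = a" "has_sequence (head G e) r a"
      using assms(2) has_sequence_Suc by blast
    then have "a \<rightarrow>\<^sup>* head G e" "head G e \<rightarrow>\<^sup>* a"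
      using has_sequence_reachable by (auto intro!: reachable_adjI in_arcs_imp_in_arcs_ends)
    then have "head G e \<in> scc_of a"
      by (simp add: scc_of_def)
    then show False
      using single H(2) no_loop e by blast
  qed
  ultimately show ?thesis
    using that H(1) by (simp add: nontrivial_sccs_def)
qed

text \<open>Pigeonhole: a walk with \<open>s\<close> edges visits \<open>s + 1\<close> vertices, so
  one of them repeats, and the stretch between two visits is a closed walk.\<close>

lemma long_sequence_meets_cycle:
  assumes "finite (verts G)" "has_sequence a s b" "card (verts G) \<le> s"
  obtains c t u r where "s = t + u" "has_sequence a t c" "has_sequence c u b"
    "r > 0" "has_sequence c r c"
proof -
  obtain p where p: "awalk a p b" "length p = s"
    using assms(2) by (auto simp: has_sequence_def)
  have "\<not> distinct (awalk_verts a p)"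
  proof
    assume "distinct (awalk_verts a p)"
    then have "card (set (awalk_verts a p)) = Suc s"
      by (simp add: distinct_card length_awalk_verts p(2))
    moreover have "set (awalk_verts a p) \<subseteq> verts G"
      using p(1) unfolding awalk_conv by (rule conjunct1)
    then have "card (set (awalk_verts a p)) \<le> card (verts G)"
      by (rule card_mono[OF assms(1)])
    ultimately show False
      using assms(3) by linarith
  qed
  then obtain q r t w where qrt: "p = q @ r @ t" "0 < length r"
      "awalk a q w" "awalk w r w" "awalk w t b"
    using awalk_not_distinct_decomp[OF p(1)] by blast
  show ?thesis
  proof (rule that)
    \<comment> \<open>The walk is only split at \<open>w\<close>, not shortened: the cycle
      \<open>r\<close> stays in the second piece.\<close>
    show "s = length q + (length r + length t)"
      using p(2) qrt(1) by simp
    show "has_sequence w (length r + length t) b"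
      using qrt has_sequence_trans unfolding has_sequence_def by blast
    show "has_sequence a (length q) w" "length r > 0" "has_sequence w (length r) w"
      using qrt unfolding has_sequence_def by blast+
  qed
qed

end

section \<open>Zero coordinates under iteration\<close>

lemma monomial_system_nth_eq_0_iff:
  fixes f :: "bit ^ 'n \<Rightarrow> bit ^ 'n"
  assumes "monomial_system f"
  shows "f x $ i = 0 \<longleftrightarrow> (\<exists>j. matrix_of f $ i $ j = 1 \<and> x $ j = 0)"
proof -
  have em: "exponent_matrix f (matrix_of f)"
    using assms by (rule exponent_matrix_matrix_of)
  then have "matrix_of f $ i $ j \<noteq> 0 \<longleftrightarrow> matrix_of f $ i $ j = 1" for j
    unfolding exponent_matrix_def by (metis insertE singletonD zero_neq_one)
  \<comment> \<open>Because \<open>0 ^ 0 = 1\<close>, a factor of the product vanishes only if its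
    exponent is 1 and its base is 0.\<close>
  then show ?thesis
    using em by (auto simp: exponent_matrix_def)
qed

text \<open>Arcs point from a coordinate to those it depends on, so the outermost application of
  \<open>f\<close> contributes the first arc of the walk.\<close>

lemma monomial_system_funpow_nth_eq_0_iff:
  fixes f :: "bit ^ 'n \<Rightarrow> bit ^ 'n"
  assumes "monomial_system f"
  shows "(f ^^ m) x $ i = 0 \<longleftrightarrow>
    (\<exists>j. pre_digraph.has_sequence (dependency_graph f) i m j \<and> x $ j = 0)"
proof -
  interpret wf_digraph "dependency_graph f"
    by (rule wf_dependency_graph)
  show ?thesis
  proof (induction m arbitrary: i)
    case 0
    have "verts (dependency_graph f) = UNIV"
      by (simp add: dependency_graph_def)
    then show ?case
      by (simp add: has_sequence_0)
  next
    case (Suc m)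
    show ?case
      unfolding funpow.simps comp_apply monomial_system_nth_eq_0_iff[OF assms] Suc.IH
        has_sequence_Suc
      by (auto simp: dependency_graph_def)
  qed
qed

lemma bit_vec_eqI:
  fixes x y :: "bit ^ 'n"
  assumes "\<And>i. x $ i = 0 \<longleftrightarrow> y $ i = 0"
  shows "x = y"
  unfolding vec_eq_iff
proof
  fix i
  show "x $ i = y $ i"
    using assms[of i] by (cases "x $ i"; cases "y $ i") simp_all
qed

text \<open>A point is determined by its zero set, a subset of a finite type. Finiteness makes every
  orbit eventually periodic.\<close>

lemma finite_UNIV_bit_vec: "finite (UNIV :: (bit ^ 'n) set)"
proof (rule inj_on_finite[where B = UNIV])
  show "inj (\<lambda>x :: bit ^ 'n. {i. x $ i = 0})"
  proof (rule injI)
    fix x y :: "bit ^ 'n"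
    assume "{i. x $ i = 0} = {i. y $ i = 0}"
    then show "x = y"
      by (intro bit_vec_eqI) blast
  qed
qed simp_all

section \<open>Fixed points and loop numbers\<close>

theorem theorem43:
  fixes f :: "bit ^ 'n \<Rightarrow> bit ^ 'n"
  assumes "monomial_system f" and "coupled f"
  shows "fixed_point_system f \<longleftrightarrow>
    (\<forall>H \<in> pre_digraph.nontrivial_sccs (dependency_graph f).
       pre_digraph.scc_loop_number (dependency_graph f) H = 1)"
proof -
  interpret wf_digraph "dependency_graph f"
    by (rule wf_dependency_graph)
  note zero_iff = monomial_system_funpow_nth_eq_0_iff[OF assms(1)]
  have scc_loop: "scc_loop_number H = loop_number a" if "H \<in> nontrivial_sccs" "a \<in> verts H" for H a
    using that scc_loop_number_eq by (simp add: nontrivial_sccs_def)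
  show ?thesis
  proof
    assume fps: "fixed_point_system f"
    show "\<forall>H\<in>nontrivial_sccs. scc_loop_number H = 1"
    proof
      fix H assume H: "H \<in> nontrivial_sccs"
      then have "strongly_connected H"
        by (auto simp: nontrivial_sccs_def)
      then obtain a where a: "a \<in> verts H"
        by (auto simp: strongly_connected_def)
      obtain s where s: "s > 0" "has_sequence a s a"
        using nontrivial_scc_closed_walk[OF H a] .
      define x :: "bit ^ 'n" where "x = (\<chi> j. if j = a then 0 else 1)"
      have x: "(f ^^ m) x $ a = 0 \<longleftrightarrow> has_sequence a m a" for m
        by (simp add: zero_iff x_def if_distrib cong: if_cong)
      obtain m where m: "f ((f ^^ m) x) = (f ^^ m) x"
        using fps unfolding fixed_point_system_def by blast
      have const: "(f ^^ (k + m)) x = (f ^^ m) x" for k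
        by (induction k) (simp_all add: m)
      \<comment> \<open>Since \<open>s \<ge> 1\<close>, both \<open>m * s\<close> and its successor
        lie in the constant tail of the orbit, and \<open>m * s\<close> is the length of a closed
        walk at \<open>a\<close>.\<close>
      have "m * s = (m * s - m) + m" "Suc (m * s) = Suc (m * s - m) + m"
        using s(1) by simp_all
      then have "(f ^^ (m * s)) x = (f ^^ Suc (m * s)) x"
        using const by metis
      moreover have "has_sequence a (m * s) a"
        using s(2) by (rule has_sequence_mult)
      ultimately have "loop_number a = 1"
        using x loop_number_eq_1_iff by metis
      then show "scc_loop_number H = 1"
        using scc_loop[OF H a] by simp
    qed
  next
    assume one: "\<forall>H\<in>nontrivial_sccs. scc_loop_number H = 1"
    show "fixed_point_system f"
      unfolding fixed_point_system_def
    proof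
      fix x
      have "\<not> inj (\<lambda>m. (f ^^ m) x)"
        using finite_UNIV_bit_vec infinite_UNIV_nat inj_on_finite subset_UNIV by metis
      then obtain k l where kl: "k < l" "(f ^^ k) x = (f ^^ l) x"
        unfolding inj_def by (metis linorder_neqE_nat)
      \<comment> \<open>It remains to show that the periodic point \<open>y\<close> is
        fixed.\<close>
      define y p where "y = (f ^^ k) x" and "p = l - k"
      have "p > 0"
        using kl(1) by (simp add: p_def)
      have "(f ^^ p) y = y"
        using kl funpow_add[of p k f] by (simp add: y_def p_def)
      then have "(f ^^ (q * p)) y = y" for q
        by (induction q) (simp_all add: funpow_add)
      then have period: "(f ^^ (m + q * p)) y = (f ^^ m) y" for m q
        by (simp add: funpow_add)
      have step: "(f ^^ Suc m) y $ i = 0" if "(f ^^ m) y $ i = 0" for m i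
      proof -
        let ?n = "CARD('n)"
        \<comment> \<open>Adding \<open>?n\<close> periods keeps the zero and makes the walk that
          witnesses it long enough to meet a cycle.\<close>
        have "(f ^^ (m + ?n * p)) y $ i = 0"
          using that period by simp
        then obtain j where j: "has_sequence i (m + ?n * p) j" "y $ j = 0"
          using zero_iff by blast
        have fin: "finite (verts (dependency_graph f))"
          by simp
        have card: "card (verts (dependency_graph f)) \<le> m + ?n * p"
          using \<open>p > 0\<close> by (simp add: dependency_graph_def trans_le_add2)
        obtain c t u r where c: "m + ?n * p = t + u" "has_sequence i t c" "has_sequence c u j"
            and r: "r > 0" "has_sequence c r c"
          using long_sequence_meets_cycle[OF fin j(1) card] .
        obtain H where "H \<in> nontrivial_sccs" "c \<in> verts H"
          using closed_walk_nontrivial_scc[OF r] .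
        then have "loop_number c = 1"
          using one scc_loop by force
        then obtain v where v: "has_sequence c v c" "has_sequence c (Suc v) c"
          using loop_number_eq_1_iff by blast
        \<comment> \<open>The detour at \<open>c\<close> gets length \<open>v * v * p + 1\<close>:
          large enough to be realised, and congruent to 1 modulo \<open>p\<close>, so that it
          amounts to one further application of \<open>f\<close>.\<close>
        have "v * v * 1 \<le> v * v * p"
          using \<open>p > 0\<close> by (intro mult_le_mono2) simp
        then have "v * v \<le> v * v * p + 1"
          by linarith
        then have "has_sequence c (v * v * p + 1) c"
          by (rule has_sequence_consecutive[OF v])
        then have "has_sequence i (t + (v * v * p + 1 + u)) j"
          using c has_sequence_trans by blast
        moreover have "t + (v * v * p + 1 + u) = Suc m + (?n + v * v) * p"
          using c(1) by (simp add: algebra_simps)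
        ultimately have "(f ^^ (Suc m + (?n + v * v) * p)) y $ i = 0"
          using j(2) zero_iff by metis
        then show ?thesis
          using period by metis
      qed
      have iter: "(f ^^ (m + q)) y $ i = 0" if "(f ^^ m) y $ i = 0" for m q i
        using that step by (induction q) simp_all
      have "f y $ i = 0 \<longleftrightarrow> y $ i = 0" for i
      proof
        assume "f y $ i = 0"
        \<comment> \<open>A zero present at time 1 survives until time \<open>p\<close>, when the
          orbit is back at \<open>y\<close>.\<close>
        then have "(f ^^ (1 + (p - 1))) y $ i = 0"
          by (intro iter) simp
        then show "y $ i = 0"
          using \<open>(f ^^ p) y = y\<close> \<open>p > 0\<close> by simp
      next
        assume "y $ i = 0"
        then show "f y $ i = 0"
          using step[of 0 i] by simp
      qed
      then have "f y = y"
        by (rule bit_vec_eqI)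
      then show "\<exists>m. f ((f ^^ m) x) = (f ^^ m) x"
        unfolding y_def by blast
    qed
  qed
qed

end
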